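(* Let $\mathfrak{L}_2$ be the $4$-dimensional complex Leibniz algebra with basis $e_1,\dots,e_4$ and nonzero brackets $[e_1,e_2]=e_3=-[e_2,e_1]$, $[e_1,e_4]=e_1=-[e_4,e_1]$, $[e_4,e_2]=e_2=-[e_2,e_4]$, $[e_4,e_4]=e_3$. Then $\mathfrak{L}_2$ has no metric deformations.
   Context: All algebras are over $\mathbb{C}$. A left (resp. right) Leibniz algebra is a vector space $\mathfrak{L}$ with a bilinear bracket satisfying $[x,[y,z]]=[[x,y],z]+[y,[x,z]]$ (resp. $[x,[y,z]]=[[x,y],z]-[[x,z],y]$); a Leibniz algebra is one or the other. A bilinear form $B$ on $\mathfrak{L}$ is invariant if $B([x,y],z)=B(x,[y,z])$ for all $x,y,z$. $\mathfrak{L}$ is metric if it has a non-degenerate symmetric invariant bilinear form. A (formal $1$-parameter, Leibniz) deformation of $(\mathfrak{L},\mu_0)$ is a Leibniz bracket $\mu_t=\mu_0+t\phi_1+t^2\phi_2+\cdots$ on $\mathfrak{L}\otimes\mathbb{C}[[t]]$, with $\phi_i$ bilinear maps $\mathfrak{L}\times\mathfrak{L}\to\mathfrak{L}$. Two deformations $\mu_t,\tilde\mu_t$ are equivalent if $\tilde\mu_t(x,y)=\Phi_t\mu_t(\Phi_t^{-1}x,\Phi_t^{-1}y)$ for some $\Phi_t=\mathrm{id}+t\,\Phi_1+t^2\Phi_2+\cdots$ with linear $\Phi_i$; a deformation equivalent to $\mu_0$ is trivial. A metric deformation is a non-trivial deformation $\mu_t$ that is a metric Leibniz algebra for $t\neq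 0$ (for formal $t$: after extending scalars to $\mathbb{C}((t))$). *)

theory Defs
  imports "HOL-Analysis.Analysis" "HOL-Computational_Algebra.Formal_Laurent_Series"
begin

text \<open>
  A finite-dimensional algebra over a commutative ring is a bracket on a coordinate module
  \<open>'a ^ 'n\<close>. Linearity is \<^const>\<open>module_hom\<close> for the scalar multiplication \<open>*s\<close> of the
  coefficient ring, since \<^const>\<open>bilinear\<close> of the library is bilinearity over the reals.
\<close>

type_synonym ('a, 'n) bracket = "'a ^ 'n \<Rightarrow> 'a ^ 'n \<Rightarrow> 'a ^ 'n"

definition bilinear_bracket :: "('a::comm_ring_1, 'n::finite) bracket \<Rightarrow> bool" where
  "bilinear_bracket \<mu> \<longleftrightarrow>
     (\<forall>x. module_hom (*s) (*s) (\<lambda>y. \<mu> x y)) \<and> (\<forall>y. module_hom (*s) (*s) (\<lambda>x. \<mu> x y))"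

definition bilinear_form :: "('a::comm_ring_1 ^ 'n::finite \<Rightarrow> 'a ^ 'n \<Rightarrow> 'a) \<Rightarrow> bool" where
  "bilinear_form B \<longleftrightarrow>
     (\<forall>x. module_hom (*s) (*) (\<lambda>y. B x y)) \<and> (\<forall>y. module_hom (*s) (*) (\<lambda>x. B x y))"

definition left_leibniz :: "('a::comm_ring_1, 'n::finite) bracket \<Rightarrow> bool" where
  "left_leibniz \<mu> \<longleftrightarrow> bilinear_bracket \<mu> \<and>
     (\<forall>x y z. \<mu> x (\<mu> y z) = \<mu> (\<mu> x y) z + \<mu> y (\<mu> x z))"

definition right_leibniz :: "('a::comm_ring_1, 'n::finite) bracket \<Rightarrow> bool" where
  "right_leibniz \<mu> \<longleftrightarrow> bilinear_bracket \<mu> \<and>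
     (\<forall>x y z. \<mu> x (\<mu> y z) = \<mu> (\<mu> x y) z - \<mu> (\<mu> x z) y)"

definition leibniz :: "('a::comm_ring_1, 'n::finite) bracket \<Rightarrow> bool" where
  "leibniz \<mu> \<longleftrightarrow> left_leibniz \<mu> \<or> right_leibniz \<mu>"

definition symmetric_form :: "('a ^ 'n \<Rightarrow> 'a ^ 'n \<Rightarrow> 'a) \<Rightarrow> bool" where
  "symmetric_form B \<longleftrightarrow> (\<forall>x y. B x y = B y x)"

definition invariant_form :: "('a, 'n) bracket \<Rightarrow> ('a ^ 'n \<Rightarrow> 'a ^ 'n \<Rightarrow> 'a) \<Rightarrow> bool" where
  "invariant_form \<mu> B \<longleftrightarrow> (\<forall>x y z. B (\<mu> x y) z = B x (\<mu> y z))"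

text \<open>Only used for symmetric forms, so the left radical suffices.\<close>

definition nondegenerate_form :: "('a::zero ^ 'n \<Rightarrow> 'a ^ 'n \<Rightarrow> 'a) \<Rightarrow> bool" where
  "nondegenerate_form B \<longleftrightarrow> (\<forall>x. (\<forall>y. B x y = 0) \<longrightarrow> x = 0)"

definition metric_leibniz :: "('a::field, 'n::finite) bracket \<Rightarrow> bool" where
  "metric_leibniz \<mu> \<longleftrightarrow> leibniz \<mu> \<and>
     (\<exists>B. bilinear_form B \<and> nondegenerate_form B \<and> symmetric_form B \<and> invariant_form \<mu> B)"

text \<open>
  The module \<open>L \<otimes> \<complex>[[t]]\<close> for \<open>L = \<complex> ^ 'n\<close> is \<open>complex fps ^ 'n\<close>. A sequence \<open>\<phi>\<close> of bilinear
  maps on \<open>L\<close> encodes \<open>\<phi> 0 + t \<phi> 1 + t\<^sup>2 \<phi> 2 + \<dots>\<close>, which is the \<open>\<complex>[[t]]\<close>-bilinear map taking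
  the value \<open>\<Sum>m. t^m \<phi> m e\<^sub>i e\<^sub>j\<close> on the basis vectors \<open>e\<^sub>i\<close>, \<open>e\<^sub>j\<close>; likewise for a sequence of
  linear maps.
\<close>

definition formal_bracket :: "(nat \<Rightarrow> (complex, 'n::finite) bracket) \<Rightarrow> (complex fps, 'n) bracket"
  where "formal_bracket \<phi> x y =
     (\<Sum>i\<in>UNIV. \<Sum>j\<in>UNIV. (x $ i * y $ j) *s
        (\<chi> k. Abs_fps (\<lambda>m. \<phi> m (axis i 1) (axis j 1) $ k)))"

definition formal_map ::
    "(nat \<Rightarrow> complex ^ 'n::finite \<Rightarrow> complex ^ 'n) \<Rightarrow> complex fps ^ 'n \<Rightarrow> complex fps ^ 'n"
  where "formal_map \<Phi> x =
     (\<Sum>i\<in>UNIV. (x $ i) *s (\<chi> k. Abs_fps (\<lambda>m. \<Phi> m (axis i 1) $ k)))"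

definition deformation ::
    "(complex, 'n::finite) bracket \<Rightarrow> (nat \<Rightarrow> (complex, 'n) bracket) \<Rightarrow> bool" where
  "deformation \<mu>\<^sub>0 \<phi> \<longleftrightarrow>
     \<phi> 0 = \<mu>\<^sub>0 \<and> (\<forall>m. bilinear_bracket (\<phi> m)) \<and> leibniz (formal_bracket \<phi>)"

text \<open>The condition \<open>\<Phi> 0 = id\<close> makes \<open>formal_map \<Phi>\<close> bijective, so \<^const>\<open>inv\<close> is its inverse.\<close>

definition equivalent_deformations ::
    "(nat \<Rightarrow> (complex, 'n::finite) bracket) \<Rightarrow> (nat \<Rightarrow> (complex, 'n) bracket) \<Rightarrow> bool" where
  "equivalent_deformations \<phi> \<psi> \<longleftrightarrow>
     (\<exists>\<Phi>. \<Phi> 0 = id \<and> (\<forall>m. module_hom (*s) (*s) (\<Phi> m)) \<and>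
        (\<forall>x y. formal_bracket \<psi> x y =
           formal_map \<Phi>
             (formal_bracket \<phi> (inv (formal_map \<Phi>) x) (inv (formal_map \<Phi>) y))))"

definition constant_deformation ::
    "(complex, 'n::finite) bracket \<Rightarrow> nat \<Rightarrow> (complex, 'n) bracket" where
  "constant_deformation \<mu>\<^sub>0 m = (if m = 0 then \<mu>\<^sub>0 else (\<lambda>x y. 0))"

definition trivial_deformation ::
    "(complex, 'n::finite) bracket \<Rightarrow> (nat \<Rightarrow> (complex, 'n) bracket) \<Rightarrow> bool" where
  "trivial_deformation \<mu>\<^sub>0 \<phi> \<longleftrightarrow> equivalent_deformations (constant_deformation \<mu>\<^sub>0) \<phi>"

text \<open>Extension of scalars from \<open>\<complex>[[t]]\<close> to the field \<open>\<complex>((t))\<close>, by the same structure constants.\<close>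

definition laurent_bracket :: "(complex fps, 'n::finite) bracket \<Rightarrow> (complex fls, 'n) bracket"
  where "laurent_bracket \<mu> x y =
     (\<Sum>i\<in>UNIV. \<Sum>j\<in>UNIV. (x $ i * y $ j) *s
        (\<chi> k. fps_to_fls (\<mu> (axis i 1) (axis j 1) $ k)))"

definition metric_deformation ::
    "(complex, 'n::finite) bracket \<Rightarrow> (nat \<Rightarrow> (complex, 'n) bracket) \<Rightarrow> bool" where
  "metric_deformation \<mu>\<^sub>0 \<phi> \<longleftrightarrow>
     deformation \<mu>\<^sub>0 \<phi> \<and> \<not> trivial_deformation \<mu>\<^sub>0 \<phi> \<and>
     metric_leibniz (laurent_bracket (formal_bracket \<phi>))"

lemma bilinear_formal_bracket: "bilinear_bracket (formal_bracket \<phi>)"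
  unfolding bilinear_bracket_def module_hom_def module_hom_axioms_def
  by (auto simp: formal_bracket_def vec_eq_iff vec.module_axioms algebra_simps
      module_def sum.distrib sum_distrib_left)

lemma bilinear_laurent_bracket: "bilinear_bracket (laurent_bracket \<mu>)"
  unfolding bilinear_bracket_def module_hom_def module_hom_axioms_def
  by (auto simp: laurent_bracket_def vec_eq_iff algebra_simps
      module_def sum.distrib sum_distrib_left)

lemma bilinear_bracket_expand:
  assumes "bilinear_bracket \<mu>"
  shows "\<mu> x y = (\<Sum>i\<in>UNIV. \<Sum>j\<in>UNIV. (x $ i * y $ j) *s \<mu> (axis i 1) (axis j 1))"
proof -
  have l: "module_hom (*s) (*s) (\<lambda>x. \<mu> x y)" and r: "module_hom (*s) (*s) (\<lambda>y. \<mu> x y)" for x y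
    using assms by (auto simp: bilinear_bracket_def)
  have "\<mu> x y = \<mu> (\<Sum>i\<in>UNIV. x $ i *s axis i 1) (\<Sum>j\<in>UNIV. y $ j *s axis j 1)"
    by (simp only: basis_expansion)
  also have "\<dots> = (\<Sum>i\<in>UNIV. x $ i *s (\<Sum>j\<in>UNIV. y $ j *s \<mu> (axis i 1) (axis j 1)))"
    by (subst module_hom.sum[OF l], subst module_hom.scale[OF l],
        subst module_hom.sum[OF r], subst module_hom.scale[OF r]) (rule refl)
  finally show ?thesis
    by (simp add: vec_eq_iff sum_distrib_left mult.assoc)
qed

lemma formal_bracket_const:
  assumes "\<And>m. bilinear_bracket (\<phi> m)"
  shows "formal_bracket \<phi> (\<chi> i. fps_const (x $ i)) (\<chi> i. fps_const (y $ i)) =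
    (\<chi> k. Abs_fps (\<lambda>m. \<phi> m x y $ k))"
proof -
  have "\<phi> m x y $ k = (\<Sum>i\<in>UNIV. \<Sum>j\<in>UNIV. x $ i * y $ j * \<phi> m (axis i 1) (axis j 1) $ k)" for m k
    by (subst bilinear_bracket_expand[OF assms]) simp
  then show ?thesis
    by (simp add: formal_bracket_def vec_eq_iff fps_eq_iff fps_sum_nth flip: fps_const_mult)
       (simp add: mult.assoc)
qed

text \<open>The bracket in coordinates; its table on the basis is given by \<open>L2_basis\<close> below.\<close>

definition L2 :: "(complex, 4) bracket" where
  "L2 x y =
     (x $ 1 * y $ 4 - x $ 4 * y $ 1) *s axis 1 1 +
     (x $ 4 * y $ 2 - x $ 2 * y $ 4) *s axis 2 1 +
     (x $ 1 * y $ 2 - x $ 2 * y $ 1 + x $ 4 * y $ 4) *s axis 3 1"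

lemma L2_basis:
  defines "e \<equiv> \<lambda>i. axis i 1"
  shows "L2 (e 1) (e 2) = e 3" "L2 (e 2) (e 1) = - e 3"
    "L2 (e 1) (e 4) = e 1" "L2 (e 4) (e 1) = - e 1"
    "L2 (e 4) (e 2) = e 2" "L2 (e 2) (e 4) = - e 2"
    "L2 (e 4) (e 4) = e 3"
    "L2 (e 1) (e 1) = 0" "L2 (e 2) (e 2) = 0"
    "L2 (e 3) (e i) = 0" "L2 (e i) (e 3) = 0"
  unfolding e_def L2_def
  by (simp_all add: vec_eq_iff forall_4 axis_def)

lemma bilinear_L2: "bilinear_bracket L2"
  unfolding bilinear_bracket_def module_hom_def module_hom_axioms_def
  by (auto simp: L2_def vec_eq_iff forall_4 axis_def vec.module_axioms algebra_simps)

lemma left_leibniz_L2: "left_leibniz L2"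
  unfolding left_leibniz_def using bilinear_L2
  by (auto simp: L2_def vec_eq_iff forall_4 axis_def algebra_simps)

lemma right_leibniz_L2: "right_leibniz L2"
  unfolding right_leibniz_def using bilinear_L2
  by (auto simp: L2_def vec_eq_iff forall_4 axis_def algebra_simps)

end

theory Submission
  imports Defs
begin

text \<open>
  \<open>L2\<close> is itself metric, and it is rigid among metric Leibniz algebras. After clearing
  denominators the invariant form \<open>B\<close> lives over \<open>\<complex>[[t]]\<close>. The square \<open>w = [e\<^sub>4, e\<^sub>4]\<close> is
  central and orthogonal to all brackets, hence every bracket lies in the span of \<open>w\<close>,
  \<open>u\<^sub>1 = [e\<^sub>1, e\<^sub>4]\<close> and \<open>u\<^sub>2 = [e\<^sub>4, e\<^sub>2]\<close>; invariance forces \<open>[u\<^sub>1, u\<^sub>2]\<close> into the span of \<open>w\<close>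
  and makes brackets anticommute with everything. The derivation \<open>D = [\<cdot>, e\<^sub>4]\<close> is then traceless
  modulo \<open>w\<close>, with eigenvalues \<open>\<plusminus>\<eta>\<close>, where \<open>\<eta>\<^sup>2\<close> is a power series with constant term \<open>1\<close>. Exact
  eigenvectors \<open>f\<^sub>1\<close>, \<open>f\<^sub>2\<close> of \<open>D\<close>, together with \<open>w\<close> and \<open>e\<^sub>4\<close>, have the bracket table of \<open>L2\<close>
  up to unit factors, and rescaling gives an equivalence with the constant deformation.
\<close>


section \<open>Perturbations of the standard basis over power series\<close>

definition const_part :: "'a::zero fps ^ 'n \<Rightarrow> 'a ^ 'n" where
  "const_part x = (\<chi> k. x $ k $ 0)"

lemma const_part_simps [simp]:
  fixes x y :: "'a::comm_ring_1 fps ^ 'n"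
  shows "const_part (x + y) = const_part x + const_part y"
    "const_part (x - y) = const_part x - const_part y"
    "const_part (- x) = - const_part x"
    "const_part (a *s x) = a $ 0 *s const_part x"
    "const_part (0 :: 'a fps ^ 'n) = 0"
    "const_part (axis i 1 :: 'a fps ^ 'n) = axis i 1"
  by (simp_all add: const_part_def vec_eq_iff axis_def)

text \<open>If \<open>g\<close> reduces to the standard basis, the system \<open>y = \<Sum>\<^sub>i x\<^sub>i g\<^sub>i\<close> is unitriangular in the
  coefficients of \<open>x\<close>, so it is solved by recursion on the order.\<close>

fun combination_inv_coeff ::
    "('n::finite \<Rightarrow> 'a::comm_ring_1 fps ^ 'n) \<Rightarrow> 'a fps ^ 'n \<Rightarrow> nat \<Rightarrow> 'n \<Rightarrow> 'a" where
  "combination_inv_coeff g y n k =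
     y $ k $ n - (\<Sum>j<n. \<Sum>i\<in>UNIV. combination_inv_coeff g y j i * g i $ k $ (n - j))"

declare combination_inv_coeff.simps [simp del]

text \<open>In each Cauchy product the top term \<open>j = n\<close> meets
  \<open>g i $ k $ 0\<close>, a Kronecker delta, and so leaves \<open>x $ k $ n\<close>; all other
  terms involve lower coefficients of \<open>x\<close>.\<close>

lemma combination_nth:
  fixes g :: "'n::finite \<Rightarrow> 'a::comm_ring_1 fps ^ 'n"
  assumes "\<And>i. const_part (g i) = axis i 1"
  shows "(\<Sum>i\<in>UNIV. x $ i *s g i) $ k $ n =
    x $ k $ n + (\<Sum>j<n. \<Sum>i\<in>UNIV. x $ i $ j * g i $ k $ (n - j))"
proof -
  have g0: "g i $ k $ 0 = (if k = i then 1 else 0)" for i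
    using assms[of i] by (auto simp: const_part_def vec_eq_iff axis_def)
  have "(\<Sum>i\<in>UNIV. x $ i *s g i) $ k $ n = (\<Sum>i\<in>UNIV. \<Sum>j\<le>n. x $ i $ j * g i $ k $ (n - j))"
    by (simp add: fps_sum_nth fps_mult_nth atMost_atLeast0)
  also have "\<dots> = (\<Sum>j\<le>n. \<Sum>i\<in>UNIV. x $ i $ j * g i $ k $ (n - j))"
    by (rule sum.swap)
  also have "\<dots> = (\<Sum>i\<in>UNIV. x $ i $ n * g i $ k $ 0) +
      (\<Sum>j<n. \<Sum>i\<in>UNIV. x $ i $ j * g i $ k $ (n - j))"
    by (simp add: lessThan_Suc_atMost [symmetric])
  also have "(\<Sum>i\<in>UNIV. x $ i $ n * g i $ k $ 0) = x $ k $ n"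
    by (simp add: g0 if_distrib cong: if_cong)
  finally show ?thesis .
qed

lemma bij_combination:
  fixes g :: "'n::finite \<Rightarrow> 'a::comm_ring_1 fps ^ 'n"
  assumes g: "\<And>i. const_part (g i) = axis i 1"
  shows "bij (\<lambda>x. \<Sum>i\<in>UNIV. x $ i *s g i)"
proof (rule bijI)
  show "inj (\<lambda>x. \<Sum>i\<in>UNIV. x $ i *s g i)"
  proof (rule injI)
    fix x y :: "'a fps ^ 'n"
    assume eq: "(\<Sum>i\<in>UNIV. x $ i *s g i) = (\<Sum>i\<in>UNIV. y $ i *s g i)"
    have "\<forall>k. x $ k $ n = y $ k $ n" for n
    proof (induction n rule: less_induct)
      case (less n)
      show ?case
      proof
        fix k
        have "x $ k $ n + (\<Sum>j<n. \<Sum>i\<in>UNIV. x $ i $ j * g i $ k $ (n - j)) =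
            y $ k $ n + (\<Sum>j<n. \<Sum>i\<in>UNIV. y $ i $ j * g i $ k $ (n - j))"
          using eq by (simp only: combination_nth[OF g, symmetric])
        then show "x $ k $ n = y $ k $ n"
          using less by simp
      qed
    qed
    then show "x = y"
      by (simp add: vec_eq_iff fps_eq_iff)
  qed
  show "surj (\<lambda>x. \<Sum>i\<in>UNIV. x $ i *s g i)"
  proof (rule surjI)
    fix y :: "'a fps ^ 'n"
    define x where "x = (\<chi> k. Abs_fps (\<lambda>n. combination_inv_coeff g y n k))"
    have "(\<Sum>i\<in>UNIV. x $ i *s g i) $ k $ n = y $ k $ n" for k n
      unfolding combination_nth[OF g]
      by (simp add: x_def combination_inv_coeff.simps[of g y n])
    then show "(\<Sum>i\<in>UNIV. (\<chi> k. Abs_fps (\<lambda>n. combination_inv_coeff g y n k)) $ i *s g i) = y"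
      unfolding x_def by (simp add: vec_eq_iff fps_eq_iff)
  qed
qed

lemma bilinear_bracket_combination:
  assumes "bilinear_bracket \<mu>"
  shows "\<mu> (\<Sum>i\<in>I. a i *s g i) (\<Sum>j\<in>J. b j *s h j) =
    (\<Sum>i\<in>I. \<Sum>j\<in>J. (a i * b j) *s \<mu> (g i) (h j))"
proof -
  have l: "module_hom (*s) (*s) (\<lambda>x. \<mu> x y)" and r: "module_hom (*s) (*s) (\<lambda>y. \<mu> x y)" for x y
    using assms by (auto simp: bilinear_bracket_def)
  have "\<mu> (\<Sum>i\<in>I. a i *s g i) (\<Sum>j\<in>J. b j *s h j) =
      (\<Sum>i\<in>I. a i *s (\<Sum>j\<in>J. b j *s \<mu> (g i) (h j)))"
    by (subst module_hom.sum[OF l], subst module_hom.scale[OF l],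
        subst module_hom.sum[OF r], subst module_hom.scale[OF r]) (rule refl)
  then show ?thesis
    by (simp add: vec_eq_iff sum_distrib_left mult.assoc)
qed

text \<open>The coefficients of \<open>t^m\<close> in the \<open>g i\<close> are the columns of
  \<open>\<Phi> m\<close>, so \<open>formal_map \<Phi>\<close> sends the standard basis to
  \<open>g\<close>. Equal structure constants make it intertwine the constant deformation with
  \<open>\<phi>\<close>.\<close>

lemma trivial_deformationI:
  fixes g :: "'n::finite \<Rightarrow> complex fps ^ 'n"
  assumes g: "\<And>i. const_part (g i) = axis i 1"
    and table: "\<And>i j. formal_bracket \<phi> (g i) (g j) =
      (\<Sum>k\<in>UNIV. fps_const (\<mu>\<^sub>0 (axis i 1) (axis j 1) $ k) *s g k)"
  shows "trivial_deformation \<mu>\<^sub>0 \<phi>"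
proof -
  define F where "F x = (\<Sum>i\<in>UNIV. x $ i *s g i)" for x
  define \<Phi> :: "nat \<Rightarrow> complex ^ 'n \<Rightarrow> complex ^ 'n" where
    "\<Phi> m v = (\<Sum>i\<in>UNIV. v $ i *s (\<chi> k. g i $ k $ m))" for m v
  have axis: "\<Phi> m (axis i 1) = (\<chi> k. g i $ k $ m)" for m i
    by (simp add: \<Phi>_def axis_def vec_eq_iff mult_delta_left)
  have map: "formal_map \<Phi> = F"
    by (simp add: fun_eq_iff formal_map_def F_def axis fps_nth_inverse vec_lambda_eta)
  have "\<Phi> 0 v = v" for v
  proof -
    have "\<Phi> 0 v = (\<Sum>i\<in>UNIV. v $ i *s axis i 1)"
      using g by (simp add: \<Phi>_def const_part_def)
    then show ?thesis
      by (simp only: basis_expansion)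
  qed
  then have id: "\<Phi> 0 = id"
    by (simp add: fun_eq_iff)
  have lin: "module_hom (*s) (*s) (\<Phi> m)" for m
    unfolding module_hom_def module_hom_axioms_def
    by (auto simp: \<Phi>_def vec_eq_iff vec.module_axioms algebra_simps sum.distrib sum_distrib_left)
  have bij: "bij F"
    unfolding F_def by (rule bij_combination[OF g])
  have F_sum: "F (\<Sum>i\<in>A. h i) = (\<Sum>i\<in>A. F (h i))" for A :: "'n set" and h
    by (induction A rule: infinite_finite_induct)
       (simp_all add: F_def vec_eq_iff sum.distrib algebra_simps)
  have F_scale: "F (a *s x) = a *s F x" for a x
    by (simp add: F_def vec_eq_iff sum_distrib_left mult.assoc)
  have const: "Abs_fps (\<lambda>m. constant_deformation \<mu>\<^sub>0 m x y $ k) = fps_const (\<mu>\<^sub>0 x y $ k)" for x y k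
    by (simp add: fps_eq_iff constant_deformation_def)
  have hom: "formal_bracket \<phi> (F x) (F y) = F (formal_bracket (constant_deformation \<mu>\<^sub>0) x y)" for x y
  proof -
    have "formal_bracket \<phi> (F x) (F y) =
        (\<Sum>i\<in>UNIV. \<Sum>j\<in>UNIV. (x $ i * y $ j) *s formal_bracket \<phi> (g i) (g j))"
      unfolding F_def by (rule bilinear_bracket_combination[OF bilinear_formal_bracket])
    also have "\<dots> = (\<Sum>i\<in>UNIV. \<Sum>j\<in>UNIV. (x $ i * y $ j) *s
        F (\<chi> k. fps_const (\<mu>\<^sub>0 (axis i 1) (axis j 1) $ k)))"
      by (simp add: table F_def)
    also have "\<dots> = F (formal_bracket (constant_deformation \<mu>\<^sub>0) x y)"
      by (simp add: formal_bracket_def const F_sum F_scale)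
    finally show ?thesis .
  qed
  have "formal_bracket \<phi> x y = F (formal_bracket (constant_deformation \<mu>\<^sub>0) (inv F x) (inv F y))" for x y
    using hom[of "inv F x" "inv F y"] bij by (simp add: bij_is_surj surj_f_inv_f)
  then show ?thesis
    unfolding trivial_deformation_def equivalent_deformations_def
    using map id lin by (intro exI[of _ \<Phi>]) auto
qed

section \<open>Descent of the invariant form to power series\<close>

lemma bilinear_form_expand:
  assumes "bilinear_form B"
  shows "B x y = (\<Sum>i\<in>UNIV. \<Sum>j\<in>UNIV. x $ i * y $ j * B (axis i 1) (axis j 1))"
proof -
  have l: "module_hom (*s) (*) (\<lambda>x. B x y)" and r: "module_hom (*s) (*) (\<lambda>y. B x y)" for x y
    using assms by (auto simp: bilinear_form_def)
  have "B x y = B (\<Sum>i\<in>UNIV. x $ i *s axis i 1) (\<Sum>j\<in>UNIV. y $ j *s axis j 1)"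
    by (simp only: basis_expansion)
  also have "\<dots> = (\<Sum>i\<in>UNIV. x $ i * (\<Sum>j\<in>UNIV. y $ j * B (axis i 1) (axis j 1)))"
    by (subst module_hom.sum[OF l], subst module_hom.scale[OF l],
        subst module_hom.sum[OF r], subst module_hom.scale[OF r]) (rule refl)
  finally show ?thesis
    by (simp add: sum_distrib_left mult.assoc)
qed

lemma fls_clear_denominator:
  fixes f :: "'a::comm_ring_1 fls"
  shows "\<exists>N r. fps_to_fls r = fls_X ^ N * f"
proof (intro exI)
  let ?N = "nat (- fls_subdegree f)"
  have "fls_subdegree (fls_X ^ ?N * f) \<ge> 0"
    by (cases "f = 0") (auto simp: fls_X_power_times_conv_shift fls_shift_subdegree)
  then show "fps_to_fls (fls_regpart (fls_X ^ ?N * f)) = fls_X ^ ?N * f"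
    by (simp add: fls_regpart_to_fls_trivial)
qed

lemma fls_clear_denominators:
  fixes f :: "'i \<Rightarrow> 'a::comm_ring_1 fls"
  assumes "finite I"
  shows "\<exists>N. \<forall>i\<in>I. \<exists>r. fps_to_fls r = fls_X ^ N * f i"
proof -
  obtain M r where r: "\<And>i. fps_to_fls (r i) = fls_X ^ M i * f i"
    using fls_clear_denominator[of "f _"] by metis
  \<comment> \<open>The sum of the individual exponents bounds each of them, so it serves as a
    common one.\<close>
  have "fps_to_fls (fps_X ^ (sum M I - M i) * r i) = fls_X ^ sum M I * f i" if "i \<in> I" for i
  proof -
    have "sum M I = (sum M I - M i) + M i"
      using member_le_sum[of i I M] that assms by simp
    then have "fls_X ^ sum M I * f i = fls_X ^ (sum M I - M i) * (fls_X ^ M i * f i)"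
      by (metis power_add mult.assoc)
    then show ?thesis
      by (simp add: fls_times_fps_to_fls fps_to_fls_power r)
  qed
  then show ?thesis
    by blast
qed

text \<open>Stated over a domain so that it covers power series, where nondegeneracy only says that
  the radical vanishes: the Gram determinant may be a non-unit.\<close>

locale metric_leibniz_module =
  fixes \<mu> :: "('a::idom, 'n::finite) bracket" and B :: "'a ^ 'n \<Rightarrow> 'a ^ 'n \<Rightarrow> 'a"
  assumes bilinear: "bilinear_bracket \<mu>" and form: "bilinear_form B"
    and symmetric: "symmetric_form B" and invariant: "invariant_form \<mu> B"
    and nondegenerate: "nondegenerate_form B" and leibniz: "leibniz \<mu>"

text \<open>A power of \<open>t\<close> clears the denominators of the finitely many Gram entries of
  \<open>B\<close>. This nonzero factor cancels in a domain, so all properties of the form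
  survive.\<close>

lemma metric_descent:
  fixes \<mu> :: "(complex fps, 'n::finite) bracket"
  assumes bil: "bilinear_bracket \<mu>" and leib: "leibniz \<mu>"
    and metric: "metric_leibniz (laurent_bracket \<mu>)"
  shows "\<exists>B. metric_leibniz_module \<mu> B"
proof -
  obtain B where B: "bilinear_form B" "nondegenerate_form B" "symmetric_form B"
      "invariant_form (laurent_bracket \<mu>) B"
    using metric by (auto simp: metric_leibniz_def)
  define \<iota> :: "complex fps ^ 'n \<Rightarrow> complex fls ^ 'n" where "\<iota> x = (\<chi> i. fps_to_fls (x $ i))" for x
  have \<iota>_nth: "\<iota> x $ i = fps_to_fls (x $ i)" for x i
    by (simp add: \<iota>_def)
  have \<iota>_axis: "\<iota> (axis i 1) = axis i 1" for i
    by (simp add: \<iota>_def axis_def vec_eq_iff)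
  have fps_sum: "fps_to_fls (sum h A) = (\<Sum>a\<in>A. fps_to_fls (h a))" for h :: "'n \<Rightarrow> complex fps" and A
    by (induction A rule: infinite_finite_induct) auto
  have \<iota>_\<mu>: "\<iota> (\<mu> x y) = laurent_bracket \<mu> (\<iota> x) (\<iota> y)" for x y
    by (subst bilinear_bracket_expand[OF bil])
       (simp add: laurent_bracket_def vec_eq_iff \<iota>_nth fps_sum fls_times_fps_to_fls)
  define \<beta> where "\<beta> p = B (axis (fst p) 1) (axis (snd p) 1)" for p
  obtain N where "\<forall>p\<in>UNIV. \<exists>r. fps_to_fls r = fls_X ^ N * \<beta> p"
    using fls_clear_denominators[OF finite, of UNIV \<beta>] by blast
  then obtain r' where r': "\<And>p. fps_to_fls (r' p) = fls_X ^ N * \<beta> p"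
    by (metis UNIV_I)
  define r where "r i j = r' (i, j)" for i j
  have r: "fps_to_fls (r i j) = fls_X ^ N * B (axis i 1) (axis j 1)" for i j
    by (simp add: r_def r' \<beta>_def)
  define C where "C x y = (\<Sum>i\<in>UNIV. \<Sum>j\<in>UNIV. x $ i * y $ j * r i j)" for x y
  have C: "fps_to_fls (C x y) = fls_X ^ N * B (\<iota> x) (\<iota> y)" for x y
    by (subst bilinear_form_expand[OF B(1)])
       (simp add: C_def \<iota>_nth fps_sum fls_times_fps_to_fls r sum_distrib_left mult_ac)
  have C_eq: "C x y = C x' y' \<longleftrightarrow> B (\<iota> x) (\<iota> y) = B (\<iota> x') (\<iota> y')" for x y x' y'
    by (subst fps_to_fls_eq_iff [symmetric]) (simp add: C)
  have C_0: "C x y = 0 \<longleftrightarrow> B (\<iota> x) (\<iota> y) = 0" for x y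
    by (subst fps_to_fls_eq_iff [symmetric]) (simp add: C)
  show ?thesis
  proof (intro exI metric_leibniz_module.intro bil leib)
    show "bilinear_form C"
      unfolding bilinear_form_def module_hom_def module_hom_axioms_def
      by (auto simp: C_def vec.module_axioms algebra_simps module_def sum.distrib sum_distrib_left)
    show "symmetric_form C" "invariant_form \<mu> C"
      using B(3,4) by (simp_all add: symmetric_form_def invariant_form_def C_eq \<iota>_\<mu>)
    show "nondegenerate_form C"
      unfolding nondegenerate_form_def
    proof (intro allI impI)
      fix x assume x: "\<forall>y. C x y = 0"
      \<comment> \<open>Vectors over Laurent series need not lie in the image of
        \<open>\<iota>\<close>, but the basis vectors do, and linearity extends the vanishing from
        them.\<close>
      have axis: "B (\<iota> x) (axis j 1) = 0" for j
        using x[rule_format, of "axis j 1"] by (simp add: C_0 \<iota>_axis)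
      have hom: "module_hom (*s) (*) (B (\<iota> x))"
        using B(1) by (simp add: bilinear_form_def)
      have "B (\<iota> x) (\<Sum>j\<in>UNIV. y $ j *s axis j 1) = 0" for y
        by (subst module_hom.sum[OF hom], subst module_hom.scale[OF hom]) (simp add: axis)
      then have "\<forall>y. B (\<iota> x) y = 0"
        by (simp only: basis_expansion simp_thms)
      then have "\<iota> x = 0"
        using B(2) by (simp add: nondegenerate_form_def)
      then show "x = 0"
        by (simp add: vec_eq_iff \<iota>_nth)
    qed
  qed
qed


section \<open>Metric Leibniz brackets\<close>

context metric_leibniz_module
begin

lemma bracket_hom: "module_hom (*s) (*s) (\<lambda>y. \<mu> x y)" "module_hom (*s) (*s) (\<lambda>x. \<mu> x y)"
  using bilinear by (simp_all add: bilinear_bracket_def)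

lemma form_hom: "module_hom (*s) (*) (\<lambda>y. B x y)" "module_hom (*s) (*) (\<lambda>x. B x y)"
  using form by (simp_all add: bilinear_form_def)

lemmas linear_simps [simp] =
  module_hom.add[OF bracket_hom(1)] module_hom.add[OF bracket_hom(2)]
  module_hom.diff[OF bracket_hom(1)] module_hom.diff[OF bracket_hom(2)]
  module_hom.neg[OF bracket_hom(1)] module_hom.neg[OF bracket_hom(2)]
  module_hom.scale[OF bracket_hom(1)] module_hom.scale[OF bracket_hom(2)]
  module_hom.zero[OF bracket_hom(1)] module_hom.zero[OF bracket_hom(2)]
  module_hom.add[OF form_hom(1)] module_hom.add[OF form_hom(2)]
  module_hom.diff[OF form_hom(1)] module_hom.diff[OF form_hom(2)]
  module_hom.neg[OF form_hom(1)] module_hom.neg[OF form_hom(2)]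
  module_hom.scale[OF form_hom(1)] module_hom.scale[OF form_hom(2)]
  module_hom.zero[OF form_hom(1)] module_hom.zero[OF form_hom(2)]

lemma form_sym: "B x y = B y x"
  using symmetric by (simp add: symmetric_form_def)

lemma form_inv: "B (\<mu> x y) z = B x (\<mu> y z)"
  using invariant by (simp add: invariant_form_def)

lemma form_eq_0D: "(\<And>z. B x z = 0) \<Longrightarrow> x = 0"
  using nondegenerate by (auto simp: nondegenerate_form_def)

lemma form_eqI:
  assumes "\<And>z. B x z = B y z"
  shows "x = y"
  using form_eq_0D[of "x - y"] assms by simp

text \<open>Invariance makes left and right multiplications adjoint to each other, and taking
  adjoints exchanges the left and the right Leibniz identity.\<close>

lemma left_and_right:
  shows left: "\<mu> x (\<mu> y z) = \<mu> (\<mu> x y) z + \<mu> y (\<mu> x z)"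
    and right: "\<mu> x (\<mu> y z) = \<mu> (\<mu> x y) z - \<mu> (\<mu> x z) y"
proof -
  show "\<mu> x (\<mu> y z) = \<mu> (\<mu> x y) z + \<mu> y (\<mu> x z)"
  proof (cases "left_leibniz \<mu>")
    case True
    then show ?thesis
      unfolding left_leibniz_def by blast
  next
    case False
    then have "\<And>x y z. \<mu> x (\<mu> y z) = \<mu> (\<mu> x y) z - \<mu> (\<mu> x z) y"
      using leibniz unfolding leibniz_def right_leibniz_def by blast
    then have r: "\<mu> v (\<mu> x y) = \<mu> (\<mu> v x) y - \<mu> (\<mu> v y) x" for v x y .
    have "B v (\<mu> x (\<mu> y z)) = B (\<mu> (\<mu> v x) y) z" for v
      by (simp only: form_inv)
    moreover have "B v (\<mu> (\<mu> x y) z + \<mu> y (\<mu> x z)) = B (\<mu> v (\<mu> x y) + \<mu> (\<mu> v y) x) z" for v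
      by (simp add: form_inv)
    ultimately have "B v (\<mu> x (\<mu> y z)) = B v (\<mu> (\<mu> x y) z + \<mu> y (\<mu> x z))" for v
      by (simp add: r[of v x y])
    then show ?thesis
      by (metis form_eqI form_sym)
  qed
  show "\<mu> x (\<mu> y z) = \<mu> (\<mu> x y) z - \<mu> (\<mu> x z) y"
  proof (cases "right_leibniz \<mu>")
    case True
    then show ?thesis
      unfolding right_leibniz_def by blast
  next
    case False
    then have "\<And>x y z. \<mu> x (\<mu> y z) = \<mu> (\<mu> x y) z + \<mu> y (\<mu> x z)"
      using leibniz unfolding leibniz_def left_leibniz_def by blast
    then have l: "\<mu> y (\<mu> z v) = \<mu> (\<mu> y z) v + \<mu> z (\<mu> y v)" for v .
    have "B (\<mu> x (\<mu> y z)) v = B (\<mu> (\<mu> x y) z - \<mu> (\<mu> x z) y) v" for v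
      by (simp add: form_inv l[of v])
    then show ?thesis
      by (rule form_eqI)
  qed
qed

text \<open>With a repeated argument, two terms of each Leibniz identity cancel.\<close>

lemma square_central [simp]: "\<mu> (\<mu> x x) z = 0" "\<mu> z (\<mu> x x) = 0"
  using left[of x x z] right[of z x x] by simp_all

lemma form_square_bracket [simp]: "B (\<mu> x x) (\<mu> y z) = 0"
  using form_inv[of "\<mu> x x" y z] by simp

text \<open>The right identity is antisymmetric in its last two arguments, so left multiplications
  kill \<open>\<mu> x v + \<mu> v x\<close>. By invariance such sums are orthogonal to all brackets;
  moving \<open>x\<close> across the form gives the claim.\<close>

lemma bracket_anticommute: "\<mu> x (\<mu> p q) = - \<mu> (\<mu> p q) x"
proof -
  have "B (\<mu> x (\<mu> p q) + \<mu> (\<mu> p q) x) v = 0" for v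
  proof -
    have "\<mu> q (\<mu> x v + \<mu> v x) = 0"
      by (simp add: right[of q x v] right[of q v x])
    then have "B (\<mu> p q) (\<mu> x v + \<mu> v x) = 0"
      unfolding form_inv by (simp only: linear_simps)
    moreover have "B (\<mu> x (\<mu> p q)) v = B (\<mu> p q) (\<mu> v x)"
    proof -
      have "B (\<mu> x (\<mu> p q)) v = B v (\<mu> x (\<mu> p q))"
        by (rule form_sym)
      also have "\<dots> = B (\<mu> v x) (\<mu> p q)"
        by (rule form_inv [symmetric])
      also have "\<dots> = B (\<mu> p q) (\<mu> v x)"
        by (rule form_sym)
      finally show ?thesis .
    qed
    ultimately show ?thesis
      by (simp add: form_inv[of "\<mu> p q" x v] add.commute)
  qed
  then show ?thesis
    using form_eq_0D by (simp add: eq_neg_iff_add_eq_0)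
qed

end

section \<open>Normal form of a metric bracket specialising to \<open>L2\<close>\<close>

lemma eq_neg_self: "x = - x \<Longrightarrow> x = 0" for x :: "'a::{idom, semiring_char_0}"
  by (metis add.right_inverse mult_2 mult_eq_0_iff zero_neq_numeral)

lemma vec_eq_neg_self: "x = - x \<Longrightarrow> x = 0" for x :: "'a::{idom, semiring_char_0} ^ 'n"
  by (metis eq_neg_self vec_eq_iff vector_uminus_component zero_index)

locale L2_metric_bracket = metric_leibniz_module \<mu> B
  for \<mu> :: "(complex fps, 4) bracket" and B +
  assumes const_bracket [simp]: "const_part (\<mu> x y) = L2 (const_part x) (const_part y)"
begin

abbreviation e4 :: "complex fps ^ 4" where "e4 \<equiv> axis 4 1"

definition w :: "complex fps ^ 4" where "w = \<mu> e4 e4"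

lemma w_central [simp]: "\<mu> w x = 0" "\<mu> x w = 0"
  by (simp_all add: w_def)

lemma form_w_bracket [simp]: "B w (\<mu> x y) = 0" "B (\<mu> x y) w = 0"
  using form_sym[of w "\<mu> x y"] by (simp_all add: w_def)

lemma form_w_w [simp]: "B w w = 0"
  using form_w_bracket(1)[of e4 e4] unfolding w_def .

lemma const_w [simp]: "const_part w = axis 3 1"
  by (simp add: w_def L2_basis)

lemma bracket_self [simp]: "\<mu> (\<mu> x y) (\<mu> x y) = 0"
  by (rule vec_eq_neg_self, rule bracket_anticommute)

lemma frame_bij:
  assumes p: "const_part p = axis 1 1" and q: "const_part q = axis 2 1"
  shows "bij (\<lambda>c :: complex fps ^ 4. c $ 1 *s p + c $ 2 *s q + c $ 3 *s w + c $ 4 *s e4)"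
proof -
  define h where "h i = (if i = 1 then p else if i = 2 then q else if i = 3 then w else e4)" for i :: 4
  have "\<forall>i. const_part (h i) = axis i 1"
    by (simp add: forall_4 h_def p q)
  then have "bij (\<lambda>c. \<Sum>i\<in>UNIV. c $ i *s h i)"
    by (intro bij_combination) blast
  then show ?thesis
    by (simp add: sum_4 h_def)
qed

lemma frame_span:
  assumes "const_part p = axis 1 1" "const_part q = axis 2 1"
  obtains a b c d where "x = a *s p + b *s q + c *s w + d *s e4"
proof -
  obtain v :: "complex fps ^ 4" where "x = v $ 1 *s p + v $ 2 *s q + v $ 3 *s w + v $ 4 *s e4"
    by (rule surjE[OF bij_is_surj[OF frame_bij[OF assms]], of x])
  then show ?thesis
    by (rule that)
qed

lemma frame_indep:
  assumes "const_part p = axis 1 1" "const_part q = axis 2 1"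
    and 0: "a *s p + b *s q + c *s w + d *s e4 = 0"
  shows "a = 0" "b = 0" "c = 0" "d = 0"
proof -
  define v :: "complex fps ^ 4" where
    "v = (\<chi> i. if i = 1 then a else if i = 2 then b else if i = 3 then c else d)"
  have "v = 0"
    by (rule injD[OF bij_is_inj[OF frame_bij[OF assms(1,2)]]]) (simp add: v_def 0)
  then show "a = 0" "b = 0" "c = 0" "d = 0"
    by (simp_all add: v_def vec_eq_iff forall_4)
qed

text \<open>Otherwise \<open>w\<close>, being orthogonal to itself and to all brackets, would be
  orthogonal to a whole frame.\<close>

lemma form_w_e4: "B w e4 \<noteq> 0"
proof
  assume 0: "B w e4 = 0"
  have "w = 0"
  proof (rule form_eq_0D)
    fix x
    have "const_part (\<mu> (axis 1 1) e4) = axis 1 1" "const_part (\<mu> e4 (axis 2 1)) = axis 2 1"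
      by (simp_all add: L2_basis)
    then obtain a b c d
      where x: "x = a *s \<mu> (axis 1 1) e4 + b *s \<mu> e4 (axis 2 1) + c *s w + d *s e4"
      by (rule frame_span)
    show "B w x = 0"
      unfolding x using 0 by simp
  qed
  then have "const_part w = 0"
    by simp
  then show False
    by (simp add: axis_eq_0_iff)
qed

text \<open>The pair \<open>p\<close>, \<open>q\<close> stays variable because it is instantiated
  twice: first with \<open>u1\<close>, \<open>u2\<close>, then with eigenvectors \<open>f1\<close>,
  \<open>f2\<close>. That both are brackets gives orthogonality to \<open>w\<close> and
  anticommutation.\<close>

context
  fixes p q p1 p2 q1 q2 :: "complex fps ^ 4"
  assumes p: "const_part p = axis 1 1" "p = \<mu> p1 p2"
    and q: "const_part q = axis 2 1" "q = \<mu> q1 q2"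
begin

lemma frame_form [simp]: "B w p = 0" "B w q = 0" "B p w = 0" "B q w = 0"
  unfolding p(2) q(2) by simp_all

text \<open>Pairing with \<open>w\<close> detects exactly the \<open>e4\<close> coefficient, and it
  vanishes on brackets.\<close>

lemma bracket_span:
  obtains a b c where "\<mu> x y = a *s p + b *s q + c *s w"
proof -
  obtain a b c d where abcd: "\<mu> x y = a *s p + b *s q + c *s w + d *s e4"
    by (rule frame_span[OF p(1) q(1)])
  have "d * B w e4 = B w (\<mu> x y)"
    unfolding abcd by simp
  then have "d = 0"
    using form_w_e4 by simp
  then show ?thesis
    using abcd that by simp
qed

lemma frame_anticommute: "\<mu> x p = - \<mu> p x" "\<mu> x q = - \<mu> q x"
  unfolding p(2) q(2) by (rule bracket_anticommute)+

lemma frame_self: "\<mu> p p = 0" "\<mu> q q = 0"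
  unfolding p(2) q(2) by (rule bracket_self)+

lemma frame_bracket:
  obtains \<kappa> :: "complex fps" where "\<mu> p q = \<kappa> *s w" "\<kappa> $ 0 = 1"
proof -
  obtain a b c where abc: "\<mu> p q = a *s p + b *s q + c *s w"
    by (rule bracket_span)
  define r where "r = a *s p + b *s q"
  have r: "r = \<mu> p q - c *s w"
    by (simp add: abc r_def)
  have "B (\<mu> p q) p = - B (\<mu> p q) p"
    using form_inv[of p q p] frame_anticommute(1)[of q] form_sym[of p "\<mu> p q"] by simp
  then have "B (\<mu> p q) p = 0"
    by (rule eq_neg_self)
  then have rp: "B r p = 0"
    by (simp add: r)
  have rq: "B r q = 0"
    by (simp add: r form_inv frame_self)
  have rw: "B r w = 0"
    by (simp add: r_def)
  \<comment> \<open>Both \<open>r\<close> and \<open>w\<close> are orthogonal to \<open>p\<close>,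
    \<open>q\<close> and \<open>w\<close>; this division-free combination is also orthogonal to
    \<open>e4\<close>. Independence of the frame then kills the components of
    \<open>r\<close>.\<close>
  have "B w e4 *s r - B r e4 *s w = 0"
  proof (rule form_eq_0D)
    fix x
    obtain a b c d where "x = a *s p + b *s q + c *s w + d *s e4"
      by (rule frame_span[OF p(1) q(1)])
    then show "B (B w e4 *s r - B r e4 *s w) x = 0"
      by (simp add: rp rq rw)
  qed
  then have "(B w e4 * a) *s p + (B w e4 * b) *s q + (- B r e4) *s w + 0 *s e4 = 0"
    by (simp add: r_def vec_eq_iff algebra_simps)
  from frame_indep(1,2)[OF p(1) q(1) this] have "a = 0" "b = 0"
    using form_w_e4 by simp_all
  then have pq: "\<mu> p q = c *s w"
    by (simp add: abc)
  have "c $ 0 *s axis 3 1 = const_part (\<mu> p q)"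
    unfolding pq by simp
  then have "c $ 0 *s axis 3 1 = (axis 3 1 :: complex ^ 4)"
    by (simp add: p(1) q(1) L2_basis)
  then have "c $ 0 = 1"
    by (simp add: vec_eq_iff forall_4 axis_def)
  then show ?thesis
    using pq that by blast
qed

end

lemma adapted_basis:
  obtains g :: "4 \<Rightarrow> complex fps ^ 4" where "\<And>i. const_part (g i) = axis i 1"
    "\<And>i j. \<mu> (g i) (g j) = (\<Sum>k\<in>UNIV. fps_const (L2 (axis i 1) (axis j 1) $ k) *s g k)"
proof -
  define D where "D x = \<mu> x e4" for x
  define u1 where "u1 = \<mu> (axis 1 1) e4"
  define u2 where "u2 = \<mu> e4 (axis 2 1)"
  have const_u: "const_part u1 = axis 1 1" "const_part u2 = axis 2 1"
    by (simp_all add: u1_def u2_def L2_basis)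
  note u = const_u(1) u1_def const_u(2) u2_def
  have D_simps: "D (x + y) = D x + D y" "D (x - y) = D x - D y" "D (a *s x) = a *s D x" "D w = 0"
    for x y a
    by (simp_all add: D_def)
  obtain a b c where Du1: "D u1 = a *s u1 + b *s u2 + c *s w"
    unfolding D_def by (rule bracket_span[OF u])
  obtain a' b' c' where Du2: "D u2 = a' *s u1 + b' *s u2 + c' *s w"
    unfolding D_def by (rule bracket_span[OF u])
  have "const_part (D u1) = axis 1 1" "const_part (D u2) = - axis 2 1"
    by (simp_all add: D_def const_u L2_basis)
  then have a0: "fps_nth a 0 = 1" and b0: "fps_nth b 0 = 0"
    unfolding Du1 Du2 by (simp_all add: const_u vec_eq_iff forall_4 axis_def)
  obtain \<beta> where \<beta>: "\<mu> u1 u2 = \<beta> *s w" "fps_nth \<beta> 0 = 1"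
    by (rule frame_bracket[OF u])
  txt \<open>\<open>D\<close> is a derivation killing \<open>w\<close>, so applying it to \<open>\<mu> u1 u2\<close> shows that it is
    traceless modulo \<open>w\<close>.\<close>
  have "D (\<mu> u1 u2) = \<mu> u1 (D u2) + \<mu> (D u1) u2"
    unfolding D_def using right[of u1 u2 e4] by simp
  then have "((a + b') * \<beta>) *s w = 0"
    unfolding Du1 Du2
    by (simp add: \<beta>(1) D_simps frame_self[OF u] vec_eq_iff algebra_simps)
  then have "0 *s u1 + 0 *s u2 + ((a + b') * \<beta>) *s w + 0 *s e4 = 0"
    by simp
  from frame_indep(3)[OF const_u this] have b': "b' = - a"
    using \<beta>(2) by (auto simp: add_eq_0_iff)
  \<comment> \<open>Minus the determinant of \<open>D\<close> on the span of \<open>u1\<close>,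
    \<open>u2\<close> modulo \<open>w\<close>. As the trace is zero, Cayley-Hamilton gives
    \<open>D^2 = \<delta>\<close> there.\<close>
  define \<delta> where "\<delta> = a * a + b * a'"
  \<comment> \<open>The selector \<open>\<lambda>n x. 1\<close> chooses 1 as square root of the
    constant term 1.\<close>
  define \<eta> where "\<eta> = fps_radical (\<lambda>n x. 1) 2 \<delta>"
  have \<delta>0: "fps_nth \<delta> 0 = 1"
    by (simp add: \<delta>_def a0 b0)
  have \<eta>0: "fps_nth \<eta> 0 = 1"
    by (simp add: \<eta>_def)
  have "\<eta> ^ Suc 1 = \<delta>"
    unfolding \<eta>_def
    using power_radical[of \<delta> "\<lambda>n x. 1" 1] \<delta>0 by (simp add: numeral_2_eq_2)
  then have \<eta>: "\<delta> = \<eta> * \<eta>"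
    by simp
  have DDu1: "D (D u1) = \<delta> *s u1 + (a * c + b * c') *s w"
    unfolding Du1 D_simps Du2 by (simp add: \<delta>_def b' vec_eq_iff algebra_simps)
  have DDu2: "D (D u2) = \<delta> *s u2 + (a' * c - a * c') *s w"
    unfolding Du2 D_simps Du1 by (simp add: \<delta>_def b' vec_eq_iff algebra_simps)
  \<comment> \<open>One more \<open>D\<close> kills the error terms in \<open>w\<close>, so these
    equations are exact.\<close>
  have DDDu: "D (D (D u1)) = \<delta> *s D u1" "D (D (D u2)) = \<delta> *s D u2"
    by (simp_all only: DDu1 DDu2 D_simps) simp_all
  define h :: "complex fps" where "h = fps_const (1 / 2)"
  \<comment> \<open>On \<open>u1\<close>, \<open>u2\<close> the product
    \<open>(D - \<eta>)(D + \<eta>)D\<close> vanishes, so \<open>(D + \<eta>)D\<close> and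
    \<open>(D - \<eta>)D\<close> yield eigenvectors. The outer \<open>D\<close> removes the
    \<open>w\<close> part and makes \<open>f1\<close>, \<open>f2\<close> brackets; the factor 1/2
    normalises their constant parts.\<close>
  define f1 where "f1 = D (h *s (D u1 + \<eta> *s u1))"
  define f2 where "f2 = D (h *s (D u2 - \<eta> *s u2))"
  have Df: "D f1 = \<eta> *s f1" "D f2 = - (\<eta> *s f2)"
    by (simp_all only: f1_def f2_def D_simps DDDu \<eta>) (simp_all add: vec_eq_iff algebra_simps)
  have const_f: "const_part f1 = axis 1 1" "const_part f2 = axis 2 1"
    unfolding f1_def f2_def D_def
    by (simp_all only: const_part_simps const_bracket const_u)
       (simp_all add: \<eta>0 h_def L2_def vec_eq_iff forall_4 axis_def)
  note f = const_f(1) f1_def[unfolded D_def] const_f(2) f2_def[unfolded D_def]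
  obtain \<kappa> where \<kappa>: "\<mu> f1 f2 = \<kappa> *s w" "fps_nth \<kappa> 0 = 1"
    by (rule frame_bracket[OF f])
  define \<rho> where "\<rho> = inverse \<eta>"
  define \<nu> where "\<nu> = inverse \<kappa>"
  have \<rho>: "\<rho> * \<eta> = 1" "fps_nth \<rho> 0 = 1" and \<nu>: "\<nu> * \<kappa> = 1" "fps_nth \<nu> 0 = 1"
    using \<eta>0 \<kappa>(2) by (simp_all add: \<rho>_def \<nu>_def inverse_mult_eq_1)
  \<comment> \<open>\<open>g4\<close> normalises the eigenvalues to 1 and -1, \<open>g3\<close> is
    then forced to be the square of \<open>g4\<close>, and the factor of \<open>g1\<close> turns
    \<open>\<mu> f1 f2 = \<kappa> *s w\<close> into \<open>\<mu> g1 f2 = g3\<close>.\<close>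
  define g1 where "g1 = (\<nu> * \<rho> * \<rho>) *s f1"
  define g3 where "g3 = (\<rho> * \<rho>) *s w"
  define g4 where "g4 = \<rho> *s e4"
  define g where "g i = (if i = 1 then g1 else if i = 2 then f2 else if i = 3 then g3 else g4)"
    for i :: 4
  have "\<mu> f1 e4 = \<eta> *s f1" "\<mu> f2 e4 = - (\<eta> *s f2)"
    using Df by (simp_all add: D_def)
  moreover from this have "\<mu> e4 f1 = - (\<eta> *s f1)" "\<mu> e4 f2 = \<eta> *s f2"
    using frame_anticommute[OF f] by simp_all
  moreover have "\<mu> f2 f1 = - (\<kappa> *s w)"
    using frame_anticommute(1)[OF f, of f2] \<kappa>(1) by simp
  moreover have scalars: "\<nu> * \<rho> * \<rho> * \<kappa> = \<rho> * \<rho>" "\<rho> * (\<nu> * \<rho> * \<rho> * \<eta>) = \<nu> * \<rho> * \<rho>"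
    using \<rho>(1) \<nu>(1) by algebra+
  ultimately have table: "\<mu> g1 g1 = 0" "\<mu> f2 f2 = 0" "\<mu> g1 f2 = g3" "\<mu> f2 g1 = - g3"
      "\<mu> g1 g4 = g1" "\<mu> g4 g1 = - g1" "\<mu> f2 g4 = - f2" "\<mu> g4 f2 = f2" "\<mu> g4 g4 = g3"
      "\<mu> g3 x = 0" "\<mu> x g3 = 0" for x
    by (simp_all add: g1_def g3_def g4_def \<kappa>(1) \<rho>(1) scalars frame_self[OF f]
        vector_smult_assoc flip: w_def)
  show ?thesis
  proof (rule that[of g])
    have "\<forall>i. const_part (g i) = axis i 1"
      by (simp add: forall_4 g_def g1_def g3_def g4_def const_f \<rho>(2) \<nu>(2))
    then show "const_part (g i) = axis i 1" for i
      by blast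
    have "\<forall>i j. \<mu> (g i) (g j) = (\<Sum>k\<in>UNIV. fps_const (L2 (axis i 1) (axis j 1) $ k) *s g k)"
      unfolding forall_4
      by (simp add: g_def table sum_4 L2_basis) (simp add: axis_def vec_eq_iff flip: fps_const_neg)
    then show "\<mu> (g i) (g j) = (\<Sum>k\<in>UNIV. fps_const (L2 (axis i 1) (axis j 1) $ k) *s g k)" for i j
      by blast
  qed
qed

end

section \<open>Reduction modulo \<open>t\<close> and conclusion\<close>

lemma const_part_formal_bracket:
  assumes "bilinear_bracket (\<phi> 0)"
  shows "const_part (formal_bracket \<phi> x y) = \<phi> 0 (const_part x) (const_part y)"
  by (subst bilinear_bracket_expand[OF assms])
     (simp add: formal_bracket_def const_part_def vec_eq_iff fps_sum_nth)

theorem theorem4p4: "\<not> (\<exists>\<phi>. metric_deformation L2 \<phi>)"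
proof
  assume "\<exists>\<phi>. metric_deformation L2 \<phi>"
  then obtain \<phi> where \<phi>: "deformation L2 \<phi>" "\<not> trivial_deformation L2 \<phi>"
      "metric_leibniz (laurent_bracket (formal_bracket \<phi>))"
    by (auto simp: metric_deformation_def)
  obtain B where B: "metric_leibniz_module (formal_bracket \<phi>) B"
    using metric_descent[OF bilinear_formal_bracket _ \<phi>(3)] \<phi>(1) by (auto simp: deformation_def)
  have "const_part (formal_bracket \<phi> x y) = L2 (const_part x) (const_part y)" for x y
    using \<phi>(1) const_part_formal_bracket[of \<phi> x y] by (simp add: deformation_def bilinear_L2)
  then interpret L2_metric_bracket "formal_bracket \<phi>" B
    by (intro L2_metric_bracket.intro B L2_metric_bracket_axioms.intro)
  obtain g :: "4 \<Rightarrow> complex fps ^ 4" where "\<And>i. const_part (g i) = axis i 1"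
      "\<And>i j. formal_bracket \<phi> (g i) (g j) =
        (\<Sum>k\<in>UNIV. fps_const (L2 (axis i 1) (axis j 1) $ k) *s g k)"
    by (rule adapted_basis) blast
  then have "trivial_deformation L2 \<phi>"
    by (rule trivial_deformationI)
  with \<phi>(2) show False
    by contradiction
qed

end
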